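(* Let $\mathcal{A}$ be a Rickart *-ring and $a,b\in\mathcal{A}$. Put $b_l=b\,\mathrm{lp}(b)$. Then: (a) $a\preceq^{\ell*} b$ if and only if there exists $p\in E(\mathcal{A})$ such that $a=pb$ and $p\le\mathrm{lp}(b)$; (b) $a\preceq^{\ell*|r\square} b$ if and only if there exists $p\in E(\mathcal{A})$ such that $a=pb$, $p\le\mathrm{lp}(b)$ and $pb_lp=b_lp$; (c) $a\preceq^{\ell*|\ell\square} b$ if and only if there exists $p\in E(\mathcal{A})$ such that $a=pb$, $p\le\mathrm{lp}(b)$ and $pb_lp=pb_l$; (d) $a\preceq^{\ell*|\square} b$ if and only if there exists $p\in E(\mathcal{A})$ such that $a=pb$, $p\le\mathrm{lp}(b)$ and $pb_l=b_lp$. Moreover, in each case, the element $p$ is unique.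
   Context: A *-ring is an (associative) ring $\mathcal{A}$ with an involution $*$: $(a+b)^*=a^*+b^*$, $(ab)^*=b^*a^*$, $(a^* )^*=a$. It is a Rickart *-ring if for every $a\in\mathcal{A}$ there is a self-adjoint idempotent $p$ (i.e. $p=p^*=p^2$) with $\{x\in\mathcal{A}: xa=0\}=\mathcal{A}(1-p)$; such a ring has an identity $1$, and $p$ is unique and denoted $\mathrm{lp}(a)$. Likewise, for every $a$ there is a unique self-adjoint idempotent $\mathrm{rp}(a)$ with $\{x\in\mathcal{A}: ax=0\}=(1-\mathrm{rp}(a))\mathcal{A}$. $E(\mathcal{A})$ is the set of self-adjoint idempotents, partially ordered by $p\le q$ iff $p=pq$. Partial orders on $\mathcal{A}$: $a\preceq^{\ell*} b$ iff $\mathrm{lp}(a)b=a=\mathrm{lp}(b)a$ (left star order); $a\preceq^{\ell*|\ell\square} b$ iff $a\preceq^{\ell*}b$ and $a^2=ab$; $a\preceq^{\ell*|r\square} b$ iff $a\preceq^{\ell*}b$ and $a^2=ba$; $a\preceq^{\ell*|\square} b$ iff $a\preceq^{\ell*}b$ and $a^2=ab=ba$. *)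

theory Defs
  imports Main
begin

class star_ring = ring +
  fixes star :: "'a \<Rightarrow> 'a"
  assumes star_add: "star (x + y) = star x + star y"
    and star_mult: "star (x * y) = star y * star x"
    and star_star: "star (star x) = x"

definition (in star_ring) projections :: "'a set" where
  "projections = {p. star p = p \<and> p * p = p}"

(* The unit comes from monoid_mult rather than ring_1, since the latter
   would rule out the trivial ring. *)
class rickart_star_ring = star_ring + monoid_mult +
  assumes rickart:
    "\<exists>p\<in>projections. {x. x * a = 0} = {y * (1 - p) | y. True}"

definition lp :: "'a::rickart_star_ring \<Rightarrow> 'a" where
  "lp a = (THE p. p \<in> projections \<and> {x. x * a = 0} = {y * (1 - p) | y. True})"

lemma left_annihilator_projection_unique:
  fixes p q :: "'a::rickart_star_ring"
  assumes p: "p \<in> projections" and q: "q \<in> projections"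
    and eq: "{y * (1 - p) | y. True} = {y * (1 - q) | y. True}"
  shows "p = q"
proof -
  have absorb: "s = r * s"
    if s: "s \<in> projections"
      and sub: "{y * (1 - r) | y. True} \<subseteq> {y * (1 - s) | y. True}"
    for r s :: 'a
  proof -
    have "1 * (1 - r) \<in> {y * (1 - r) | y. True}" by blast
    then obtain y where y: "1 - r = y * (1 - s)" using sub by auto
    have "(1 - s) * s = 0" using s by (simp add: projections_def left_diff_distrib)
    then have "(1 - r) * s = 0" by (simp add: y mult.assoc)
    then show ?thesis by (simp add: left_diff_distrib)
  qed
  have "q = p * q" by (rule absorb[OF q equalityD1[OF eq]])
  moreover have "p = q * p" by (rule absorb[OF p equalityD2[OF eq]])
  then have "star p = star (q * p)" by simp
  then have "p = p * q" using p q by (simp add: projections_def star_mult)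
  ultimately show ?thesis by simp
qed

lemma lp_projection: "lp a \<in> projections"
  and lp_annihilator: "{x. x * a = 0} = {y * (1 - lp a) | y. True}"
proof -
  obtain p where p: "p \<in> projections" "{x. x * a = 0} = {y * (1 - p) | y. True}"
    using rickart[of a] by (elim bexE)
  have "\<exists>!p. p \<in> projections \<and> {x. x * a = 0} = {y * (1 - p) | y. True}"
  proof (rule ex1I)
    show "p \<in> projections \<and> {x. x * a = 0} = {y * (1 - p) | y. True}"
      using p by (rule conjI)
  next
    fix q
    assume q: "q \<in> projections \<and> {x. x * a = 0} = {y * (1 - q) | y. True}"
    show "q = p"
      by (rule left_annihilator_projection_unique[OF conjunct1[OF q] p(1)
            trans[OF sym[OF conjunct2[OF q]] p(2)]])
  qed
  then have "lp a \<in> projections \<and> {x. x * a = 0} = {y * (1 - lp a) | y. True}"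
    unfolding lp_def by (rule theI')
  then show "lp a \<in> projections"
    and "{x. x * a = 0} = {y * (1 - lp a) | y. True}" by (rule conjunct1, rule conjunct2)
qed

(* The partial order on projections; only meaningful for elements of that set. *)
definition proj_le :: "'a::star_ring \<Rightarrow> 'a \<Rightarrow> bool" where
  "proj_le p q \<longleftrightarrow> p = p * q"

definition left_star_le :: "'a::rickart_star_ring \<Rightarrow> 'a \<Rightarrow> bool" where
  "left_star_le a b \<longleftrightarrow> lp a * b = a \<and> a = lp b * a"

definition left_star_left_square_le :: "'a::rickart_star_ring \<Rightarrow> 'a \<Rightarrow> bool" where
  "left_star_left_square_le a b \<longleftrightarrow> left_star_le a b \<and> a\<^sup>2 = a * b"

definition left_star_right_square_le :: "'a::rickart_star_ring \<Rightarrow> 'a \<Rightarrow> bool" where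
  "left_star_right_square_le a b \<longleftrightarrow> left_star_le a b \<and> a\<^sup>2 = b * a"

definition left_star_square_le :: "'a::rickart_star_ring \<Rightarrow> 'a \<Rightarrow> bool" where
  "left_star_square_le a b \<longleftrightarrow> left_star_le a b \<and> a\<^sup>2 = a * b \<and> a * b = b * a"

end

(* A projection p below lp b satisfies lp (p b) = p, so p = lp a is the only possible witness.
   Since x b = y b iff x (lp b) = y (lp b), the factor b cancels on the right in the
   equations relating a^2, a b and b a, after which only b (lp b) and p remain. *)
theory Submission
  imports Defs
begin

text \<open>Rewrites the left ideal in the definition of \<open>lp\<close> as an annihilator:
  \<open>x * p = 0\<close> amounts to \<open>x = x * (1 - p)\<close>.\<close>

lemma left_annihilator_projection:
  fixes p :: "'a::rickart_star_ring"
  assumes "p \<in> projections"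
  shows "{y * (1 - p) | y. True} = {x. x * p = 0}"
proof (intro equalityI subsetI)
  fix x assume "x \<in> {y * (1 - p) | y. True}"
  then obtain y where "x = y * (1 - p)" by blast
  then show "x \<in> {x. x * p = 0}"
    using assms by (simp add: projections_def mult.assoc left_diff_distrib)
next
  fix x assume "x \<in> {x. x * p = 0}"
  then have "x = x * (1 - p)" by (simp add: right_diff_distrib)
  then show "x \<in> {y * (1 - p) | y. True}" by blast
qed

lemma mult_eq_0_iff_mult_lp: "x * a = 0 \<longleftrightarrow> x * lp a = 0"
  using lp_annihilator[of a] left_annihilator_projection[OF lp_projection, of a] by blast

lemma mult_right_cancel_lp: "x * b = y * b \<longleftrightarrow> x * lp b = y * lp b"
  using mult_eq_0_iff_mult_lp[of "x - y" b] by (simp add: left_diff_distrib)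

lemma lp_eqI:
  assumes "p \<in> projections" and "\<And>x. x * a = 0 \<longleftrightarrow> x * p = 0"
  shows "lp a = p"
proof (rule left_annihilator_projection_unique[OF lp_projection assms(1)])
  show "{y * (1 - lp a) | y. True} = {y * (1 - p) | y. True}"
    unfolding lp_annihilator[symmetric] left_annihilator_projection[OF assms(1)]
    using assms(2) by blast
qed

text \<open>The involution fixes \<open>p\<close> and \<open>q\<close> and reverses products, so it
  turns \<open>p = p * q\<close> into \<open>p = q * p\<close>.\<close>

lemma proj_le_iff_left:
  assumes "p \<in> projections" and "q \<in> projections"
  shows "proj_le p q \<longleftrightarrow> q * p = p"
proof -
  have "p = p * q \<longleftrightarrow> star p = star (p * q)" by (metis star_star)
  also have "\<dots> \<longleftrightarrow> q * p = p" using assms by (auto simp: projections_def star_mult)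
  finally show ?thesis unfolding proj_le_def .
qed

text \<open>The elements \<open>p * b\<close> and \<open>p\<close> have the same left annihilator:
  \<open>x * p * b = 0\<close> iff \<open>x * p * lp b = 0\<close>, and
  \<open>p * lp b = p\<close>.\<close>

lemma lp_mult_projection:
  assumes "p \<in> projections" and "proj_le p (lp b)"
  shows "lp (p * b) = p"
proof (rule lp_eqI[OF assms(1)])
  fix x
  show "x * (p * b) = 0 \<longleftrightarrow> x * p = 0"
    using mult_eq_0_iff_mult_lp[of "x * p" b] assms(2) by (simp add: proj_le_def mult.assoc)
qed

lemma left_star_le_iff: "left_star_le a b \<longleftrightarrow> a = lp a * b \<and> proj_le (lp a) (lp b)"
proof -
  \<comment> \<open>Here \<open>a\<close> is cancelled on the right from
    \<open>lp b * a = 1 * a\<close>, leaving \<open>lp a\<close> in its place.\<close>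
  have "lp b * a = a \<longleftrightarrow> lp b * lp a = lp a"
    using mult_right_cancel_lp[of "lp b" a 1] by simp
  then show ?thesis
    by (auto simp: left_star_le_def proj_le_iff_left[OF lp_projection lp_projection])
qed

text \<open>Gives existence and uniqueness at once, because the right-hand side pins
  \<open>p\<close> down to \<open>lp a\<close>.\<close>

lemma projection_witness_iff:
  "p \<in> projections \<and> a = p * b \<and> proj_le p (lp b) \<longleftrightarrow> p = lp a \<and> left_star_le a b"
  using lp_mult_projection lp_projection by (auto simp: left_star_le_iff)

text \<open>Each equation has the form \<open>x * b = y * b\<close>, hence is equivalent to
  \<open>x * lp b = y * lp b\<close>. The factor \<open>lp b\<close> is then absorbed by an adjacent
  \<open>p\<close> on either side, or joins \<open>b\<close> to form \<open>b\<^sub>l\<close>; in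
  particular \<open>b * p = b\<^sub>l * p\<close>.\<close>

lemma projection_mult_square_iff:
  fixes b :: "'a::rickart_star_ring"
  assumes p: "p \<in> projections" and le: "proj_le p (lp b)"
  defines "b\<^sub>l \<equiv> b * lp b"
  shows "(p * b)\<^sup>2 = b * (p * b) \<longleftrightarrow> p * b\<^sub>l * p = b\<^sub>l * p" (is ?right)
    and "(p * b)\<^sup>2 = p * b * b \<longleftrightarrow> p * b\<^sub>l * p = p * b\<^sub>l" (is ?left)
    and "p * b * b = b * (p * b) \<longleftrightarrow> p * b\<^sub>l = b\<^sub>l * p" (is ?comm)
proof -
  have pq: "p * lp b = p" using le by (simp add: proj_le_def)
  have qp: "lp b * p = p" using proj_le_iff_left[OF p lp_projection] le by blast
  show ?right
    using mult_right_cancel_lp[of "p * b * p" b "b * p"]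
    by (simp add: b\<^sub>l_def power2_eq_square mult.assoc pq qp)
  show ?left
    using mult_right_cancel_lp[of "p * b * p" b "p * b"]
    by (simp add: b\<^sub>l_def power2_eq_square mult.assoc pq qp)
  show ?comm
    using mult_right_cancel_lp[of "p * b" b "b * p"]
    by (simp add: b\<^sub>l_def mult.assoc pq qp)
qed

theorem corollary26:
  fixes a b b\<^sub>l :: "'a::rickart_star_ring"
  assumes "b\<^sub>l = b * lp b"
  shows
   "(left_star_le a b \<longleftrightarrow>
       (\<exists>p\<in>projections. a = p * b \<and> proj_le p (lp b)))
  \<and> (left_star_right_square_le a b \<longleftrightarrow>
       (\<exists>p\<in>projections. a = p * b \<and> proj_le p (lp b) \<and> p * b\<^sub>l * p = b\<^sub>l * p))
  \<and> (left_star_left_square_le a b \<longleftrightarrow>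
       (\<exists>p\<in>projections. a = p * b \<and> proj_le p (lp b) \<and> p * b\<^sub>l * p = p * b\<^sub>l))
  \<and> (left_star_square_le a b \<longleftrightarrow>
       (\<exists>p\<in>projections. a = p * b \<and> proj_le p (lp b) \<and> p * b\<^sub>l = b\<^sub>l * p))
  \<and> (\<exists>\<^sub>\<le>\<^sub>1 p. p \<in> projections \<and> a = p * b \<and> proj_le p (lp b))
  \<and> (\<exists>\<^sub>\<le>\<^sub>1 p. p \<in> projections \<and> a = p * b \<and> proj_le p (lp b) \<and> p * b\<^sub>l * p = b\<^sub>l * p)
  \<and> (\<exists>\<^sub>\<le>\<^sub>1 p. p \<in> projections \<and> a = p * b \<and> proj_le p (lp b) \<and> p * b\<^sub>l * p = p * b\<^sub>l)
  \<and> (\<exists>\<^sub>\<le>\<^sub>1 p. p \<in> projections \<and> a = p * b \<and> proj_le p (lp b) \<and> p * b\<^sub>l = b\<^sub>l * p)"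
proof -
  \<comment> \<open>The four cases differ only in the extra condition \<open>Q\<close> on
    \<open>p\<close>, so they are treated together.\<close>
  have witness: "(\<exists>p\<in>projections. a = p * b \<and> proj_le p (lp b) \<and> Q p) \<longleftrightarrow> left_star_le a b \<and> Q (lp a)"
    for Q using projection_witness_iff[of _ a b] by metis
  have unique: "\<exists>\<^sub>\<le>\<^sub>1 p. p \<in> projections \<and> a = p * b \<and> proj_le p (lp b) \<and> Q p" for Q
    using projection_witness_iff[of _ a b] unfolding Uniq_def by metis
  have
    right: "a\<^sup>2 = b * a \<longleftrightarrow> lp a * b\<^sub>l * lp a = b\<^sub>l * lp a" and
    left: "a\<^sup>2 = a * b \<longleftrightarrow> lp a * b\<^sub>l * lp a = lp a * b\<^sub>l" and
    comm: "a * b = b * a \<longleftrightarrow> lp a * b\<^sub>l = b\<^sub>l * lp a"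
    if "left_star_le a b"
  proof -
    have "a = lp a * b" and le: "proj_le (lp a) (lp b)"
      using that by (simp_all add: left_star_le_iff)
    then show "a\<^sup>2 = b * a \<longleftrightarrow> lp a * b\<^sub>l * lp a = b\<^sub>l * lp a"
      and "a\<^sup>2 = a * b \<longleftrightarrow> lp a * b\<^sub>l * lp a = lp a * b\<^sub>l"
      and "a * b = b * a \<longleftrightarrow> lp a * b\<^sub>l = b\<^sub>l * lp a"
      using projection_mult_square_iff[OF lp_projection le] assms by simp_all
  qed
  \<comment> \<open>Commutation alone must also yield \<open>a\<^sup>2 = a * b\<close>: moving the
    last \<open>lp a\<close> past \<open>b\<^sub>l\<close> gives
    \<open>lp a * lp a * b\<^sub>l\<close>, and \<open>lp a\<close> is idempotent.\<close>
  have left_of_comm: "lp a * b\<^sub>l * lp a = lp a * b\<^sub>l" if "lp a * b\<^sub>l = b\<^sub>l * lp a"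
    using that lp_projection[of a] by (simp add: projections_def mult.assoc)
  have square: "left_star_square_le a b \<longleftrightarrow> left_star_le a b \<and> lp a * b\<^sub>l = b\<^sub>l * lp a"
    using left comm left_of_comm unfolding left_star_square_le_def by blast
  show ?thesis
    \<comment> \<open>The constantly true \<open>Q\<close> covers the plain left star order, which
      has no extra condition.\<close>
    using witness[of "\<lambda>_. True"] unique[of "\<lambda>_. True"] right left
    by (simp add: witness unique square left_star_right_square_le_def
        left_star_left_square_le_def cong: conj_cong)
qed

end
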